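(* Let $k\geq 3$. There exist a constant $C'=C'(k)$ and an infinite sequence of positive integers $\{n_i\}_{i=1}^\infty$ such that for every $n\in\{n_i\}_{i=1}^\infty$ and every set $A\subseteq[n]^k$ with $|A| = C'\cdot c_k(n)$, we have $$\Gamma_k(A)\ \geq\ \log^{3k+1} n\cdot\left(\frac{n^k}{c_k(n)}\right)^{k}\cdot n^{k-1} \;=\; \Upsilon(n)\cdot n^k,$$ where $\Upsilon(n)=\frac{\log^{3k+1} n}{n}\left(\frac{n^k}{c_k(n)}\right)^k$.
   Context: $[n]=\{1,\dots,n\}$. A $k$-dimensional corner in $[n]^k$ is a set of the form $\{\mathbf{a}\}\cup\{\mathbf{a}+de_i:1\le i\le k\}\subseteq[n]^k$ with $\mathbf{a}\in[n]^k$, $d>0$ an integer, and $e_1,\dots,e_k$ the standard basis vectors. $c_k(n)$ is the maximum size of a subset of $[n]^k$ containing no $k$-dimensional corner. $\Gamma_k(A)$ denotes the number of $k$-dimensional corners contained in $A$. Logarithms are base $2$. *)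

theory Defs
  imports Complex_Main "HOL-Library.FuncSet"
begin

text \<open>Points of \<open>[n]^k\<close> are extensional functions on \<open>{1..k}\<close>, so that adding
  \<open>d\<close> times the \<open>i\<close>-th standard basis vector to \<open>a\<close> is the update \<open>a(i := a i + d)\<close>.\<close>

definition grid :: "nat \<Rightarrow> nat \<Rightarrow> (nat \<Rightarrow> nat) set" where
  "grid k n = {1..k} \<rightarrow>\<^sub>E {1..n}"

definition corner :: "nat \<Rightarrow> (nat \<Rightarrow> nat) \<Rightarrow> nat \<Rightarrow> (nat \<Rightarrow> nat) set" where
  "corner k a d = {a} \<union> (\<lambda>i. a(i := a i + d)) ` {1..k}"

definition corners :: "nat \<Rightarrow> nat \<Rightarrow> (nat \<Rightarrow> nat) set set" where
  "corners k n = {corner k a d | a d. a \<in> grid k n \<and> d > 0 \<and> corner k a d \<subseteq> grid k n}"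

definition corner_free :: "nat \<Rightarrow> nat \<Rightarrow> (nat \<Rightarrow> nat) set \<Rightarrow> bool" where
  "corner_free k n A \<longleftrightarrow> (\<forall>S\<in>corners k n. \<not> S \<subseteq> A)"

definition corner_max :: "nat \<Rightarrow> nat \<Rightarrow> nat" where
  "corner_max k n = Max {card A | A. A \<subseteq> grid k n \<and> corner_free k n A}"

definition Gamma :: "nat \<Rightarrow> nat \<Rightarrow> (nat \<Rightarrow> nat) set \<Rightarrow> nat" where
  "Gamma k n A = card {S \<in> corners k n. S \<subseteq> A}"

definition Upsilon :: "nat \<Rightarrow> nat \<Rightarrow> real" where
  "Upsilon k n = log 2 (real n) ^ (3 * k + 1) / real n * (real n ^ k / real (corner_max k n)) ^ k"

end

theory Submission
  imports Defs "HOL-Real_Asymp.Real_Asymp"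
begin

text \<open>Deleting one point from each corner of \<open>A\<close> gives \<open>\<Gamma>\<^sub>k(A) \<ge> |A| - c\<^sub>k(n)\<close>, so
  \<open>C' = 2\<close> yields \<open>\<Gamma>\<^sub>k(A) \<ge> c\<^sub>k(n)\<close>. This already exceeds the required bound as soon as
  \<open>(n^k / c\<^sub>k(n))^(k+1) log^(3k+1) n \<le> n\<close>, so it suffices that corner-free sets of density
  somewhat above \<open>n^(-1/(k+1))\<close> exist for infinitely many \<open>n\<close>. The functional \<open>a\<^sub>1 + 2 a\<^sub>2\<close>
  maps a corner onto a set containing a 3-term progression, hence preimages of
  progression-free sets are corner-free. A dense enough progression-free set is a variant of
  Behrend's: numbers with digits \<open>x\<^sub>0, \<dots>, x\<^sub>m\<^sub>-\<^sub>1 < h\<close> in base \<open>2h\<close> and leading part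
  \<open>\<Sum> x\<^sub>i\<^sup>2\<close>; no carries occur when two of them are added, and strict convexity of the
  paraboloid excludes progressions. Taking \<open>m = 2k + 1\<close> the density is of order \<open>h^(-2)\<close>
  while \<open>n\<close> is of order \<open>h^(2k+3)\<close>.\<close>

text \<open>The additive form avoids truncated subtraction. Since \<open>x = y\<close> forces
  \<open>z = y\<close>, exactly the constant progressions remain.\<close>

definition ap3_free :: "nat set \<Rightarrow> bool" where
  "ap3_free B \<longleftrightarrow> (\<forall>x\<in>B. \<forall>y\<in>B. \<forall>z\<in>B. x + z = 2 * y \<longrightarrow> x = y)"

section \<open>Counting corners by deleting points\<close>

lemma finite_grid [simp]: "finite (grid k n)"
  by (simp add: grid_def finite_PiE)

lemma finite_corners: "finite (corners k n)"
  by (rule finite_subset[of _ "Pow (grid k n)"]) (auto simp: corners_def)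

lemma card_le_corner_max:
  assumes "A \<subseteq> grid k n" "corner_free k n A"
  shows "card A \<le> corner_max k n"
  unfolding corner_max_def
proof (rule Max_ge)
  have "{card A |A. A \<subseteq> grid k n \<and> corner_free k n A} \<subseteq> card ` Pow (grid k n)"
    by auto
  then show "finite {card A |A. A \<subseteq> grid k n \<and> corner_free k n A}"
    by (rule finite_subset) simp
qed (use assms in blast)

lemma card_le_Gamma_plus_corner_max:
  assumes "A \<subseteq> grid k n"
  shows "card A \<le> Gamma k n A + corner_max k n"
proof -
  let ?C = "{S \<in> corners k n. S \<subseteq> A}"
  define p where "p S = (SOME x. x \<in> S)" for S :: "(nat \<Rightarrow> nat) set"
  have p: "p S \<in> S" if "S \<in> corners k n" for S
  proof -
    have "\<exists>x. x \<in> S"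
      using that by (auto simp: corners_def corner_def)
    then show ?thesis
      unfolding p_def by (rule someI_ex)
  qed
  have "finite ?C"
    using finite_corners by simp
  \<comment> \<open>Several corners may share a chosen point, so the number of deleted points is
    only bounded above.\<close>
  then have P: "finite (p ` ?C)" "card (p ` ?C) \<le> Gamma k n A"
    by (simp_all add: Gamma_def card_image_le)
  have "corner_free k n (A - p ` ?C)"
    unfolding corner_free_def using p by blast
  then have "card (A - p ` ?C) \<le> corner_max k n"
    using assms by (intro card_le_corner_max) auto
  moreover have "card A - card (p ` ?C) \<le> card (A - p ` ?C)"
    using P(1) by (rule diff_card_le_card_Diff)
  ultimately show ?thesis
    using P(2) by linarith
qed

section \<open>Corner-free sets from progression-free sets\<close>

lemma corner_free_vimage_ap3_free:
  assumes k: "k \<ge> 2" and B: "ap3_free B"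
  shows "corner_free k n {a \<in> grid k n. \<exists>x\<in>B. a 1 + 2 * a 2 = x + s}"
  unfolding corner_free_def
proof (intro ballI notI)
  fix S assume "S \<in> corners k n" and S: "S \<subseteq> {a \<in> grid k n. \<exists>x\<in>B. a 1 + 2 * a 2 = x + s}"
  then obtain a d where "d > 0" and S_eq: "S = corner k a d"
    by (auto simp: corners_def)
  have in_S: "a \<in> S" "a(1 := a 1 + d) \<in> S" "a(2 := a 2 + d) \<in> S"
    using k by (auto simp: S_eq corner_def)
  obtain x where x: "x \<in> B" "a 1 + 2 * a 2 = x + s"
    using in_S(1) S by auto
  obtain y where y: "y \<in> B" "a 1 + d + 2 * a 2 = y + s"
    using in_S(2) S by auto
  obtain z where z: "z \<in> B" "a 1 + 2 * (a 2 + d) = z + s"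
    using in_S(3) S by auto
  \<comment> \<open>The functional takes values \<open>v\<close>, \<open>v + d\<close>,
    \<open>v + 2 * d\<close> on the three points, and the shift \<open>s\<close> cancels.\<close>
  have "x + z = 2 * y"
    using x(2) y(2) z(2) by (simp add: algebra_simps)
  then have "x = y"
    using B x(1) y(1) z(1) by (auto simp: ap3_free_def)
  then show False
    using x(2) y(2) \<open>d > 0\<close> by simp
qed

text \<open>Shifting by \<open>2 * l + 1\<close> moves \<open>B\<close> to where the fibres of
  \<open>a 1 + 2 * a 2\<close> are large: each \<open>x\<close> in \<open>B\<close> is hit by at
  least \<open>l\<close> pairs, and the other \<open>k - 2\<close> coordinates are free.\<close>

lemma corner_max_ge_ap3_free:
  assumes k: "k \<ge> 2" and B: "ap3_free B" "B \<subseteq> {..<2 * l}"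
  shows "card B * l * (2 * l) ^ (k - 2) \<le> corner_max k (2 * l)"
proof -
  let ?n = "2 * l"
  define A where "A = {a \<in> grid k ?n. \<exists>x\<in>B. a 1 + 2 * a 2 = x + Suc ?n}"
  let ?D = "B \<times> {..<l} \<times> ({3..k} \<rightarrow>\<^sub>E {1..?n})"
  \<comment> \<open>Here \<open>a 2\<close> determines
    \<open>a 1 = x mod 2 + 2 * l - 1 - 2 * j\<close>, which stays in the grid for all
    \<open>j < l\<close>.\<close>
  define g :: "nat \<times> nat \<times> (nat \<Rightarrow> nat) \<Rightarrow> nat \<Rightarrow> nat" where
    "g = (\<lambda>(x, j, r). r(1 := x + Suc ?n - 2 * (x div 2 + 1 + j), 2 := x div 2 + 1 + j))"
  have g1: "g (x, j, r) 1 + 2 * g (x, j, r) 2 = x + Suc ?n"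
    and g2: "g (x, j, r) 2 = x div 2 + 1 + j" if "j < l" for x j r
    using that by (simp_all add: g_def)
  have "inj_on g ?D"
  proof (rule inj_onI)
    fix p p' assume "p \<in> ?D" "p' \<in> ?D" "g p = g p'"
    then obtain x j r x' j' r' where p: "p = (x, j, r)" "p' = (x', j', r')" and *: "x \<in> B" "j < l" "r \<in> {3..k} \<rightarrow>\<^sub>E {1..?n}"
      "x' \<in> B" "j' < l" "r' \<in> {3..k} \<rightarrow>\<^sub>E {1..?n}"
      and eq: "g (x, j, r) = g (x', j', r')"
      by (elim SigmaE) auto
    have "x = x'"
      using g1[OF *(2), of x r] g1[OF *(5), of x' r'] eq by simp
    moreover from this have "j = j'"
      using g2[OF *(2), of x r] g2[OF *(5), of x' r'] eq by simp
    moreover have "r i = r' i" for i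
    proof (cases "i = 1 \<or> i = 2")
      case True
      \<comment> \<open>\<open>g\<close> overwrites \<open>r\<close> at 1 and 2, but both functions
        are \<open>undefined\<close> there, outside \<open>{3..k}\<close>.\<close>
      then show ?thesis
        using PiE_arb[OF *(3), of i] PiE_arb[OF *(6), of i] by auto
    next
      case False
      then show ?thesis
        using fun_cong[OF eq, of i] by (simp add: g_def)
    qed
    ultimately show "p = p'"
      unfolding p by auto
  qed
  moreover have "g ` ?D \<subseteq> A"
  proof (rule image_subsetI)
    fix p assume "p \<in> ?D"
    then obtain x j r where p: "p = (x, j, r)" and *: "x \<in> B" "j < l" "r \<in> {3..k} \<rightarrow>\<^sub>E {1..?n}"
      by (elim SigmaE) auto
    have x: "x < ?n"
      using * B by auto
    have "x \<le> 2 * (x div 2) + 1" "2 * (x div 2) \<le> x"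
      by auto
    then have c: "g (x, j, r) 1 \<in> {1..?n}" "g (x, j, r) 2 \<in> {1..?n}"
      using x g1[OF *(2), of x r] g2[OF *(2), of x r] *(2) unfolding atLeastAtMost_iff by linarith+
    have "g (x, j, r) i \<in> {1..?n}" if "i \<in> {1..k}" for i
    proof (cases "i = 1 \<or> i = 2")
      case False
      with that have "i \<in> {3..k}" by auto
      with False show ?thesis
        using PiE_mem[OF *(3)] by (auto simp: g_def)
    qed (use c in auto)
    moreover have "g (x, j, r) i = undefined" if "i \<notin> {1..k}" for i
      using that k PiE_arb[OF *(3), of i] by (auto simp: g_def)
    ultimately have "g (x, j, r) \<in> grid k ?n"
      unfolding grid_def by (intro PiE_I)
    then show "g p \<in> A"
      unfolding p A_def using g1[OF *(2)] *(1) by blast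
  qed
  moreover have "finite A"
    by (simp add: A_def)
  ultimately have "card ?D \<le> card A"
    by (metis card_image card_mono)
  also have "card A \<le> corner_max k ?n"
    unfolding A_def by (intro card_le_corner_max corner_free_vimage_ap3_free k B(1)) auto
  finally show ?thesis
    by (simp add: card_cartesian_product card_PiE Suc_diff_le numeral_3_eq_3 numeral_2_eq_2)
qed

section \<open>A progression-free set from base \<open>2 * h\<close> digits\<close>

lemma digits_unique:
  fixes u v :: "nat \<Rightarrow> nat"
  assumes "\<forall>i<m. u i < b \<and> v i < b"
    and "(\<Sum>i<m. u i * b ^ i) + b ^ m * U = (\<Sum>i<m. v i * b ^ i) + b ^ m * V" and "b > 0"
  shows "(\<forall>i<m. u i = v i) \<and> U = V"
  using assms
proof (induction m arbitrary: U V)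
  case (Suc m)
  \<comment> \<open>The top digit is absorbed into the unbounded leading part, hence the induction
    over arbitrary \<open>U\<close> and \<open>V\<close>; reduction mod \<open>b\<close> splits it
    off again.\<close>
  have "(\<Sum>i<m. u i * b ^ i) + b ^ m * (u m + b * U) = (\<Sum>i<m. v i * b ^ i) + b ^ m * (v m + b * V)"
    using Suc.prems(2) by (simp add: algebra_simps)
  moreover have "\<forall>i<m. u i < b \<and> v i < b"
    using Suc.prems(1) by simp
  ultimately have IH: "\<forall>i<m. u i = v i" "u m + b * U = v m + b * V"
    using Suc.IH[of "u m + b * U" "v m + b * V"] Suc.prems(3) by blast+
  have "(u m + b * U) mod b = (v m + b * V) mod b"
    using IH(2) by simp
  then have "u m = v m"
    using Suc.prems(1) by simp
  moreover from this have "U = V"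
    using IH(2) Suc.prems(3) by simp
  ultimately show ?case
    using IH(1) by (auto simp: less_Suc_eq)
qed auto

lemma digit_sum_less:
  fixes u :: "nat \<Rightarrow> nat"
  assumes "\<forall>i<m. u i < b"
  shows "(\<Sum>i<m. u i * b ^ i) < b ^ m"
  using assms
proof (induction m)
  case (Suc m)
  have "Suc (u m) * b ^ m \<le> b * b ^ m"
    using Suc.prems by (intro mult_right_mono) auto
  then show ?case
    using Suc by auto
qed auto

lemma exists_large_ap3_free:
  fixes h m :: nat
  assumes "h > 0" "m > 0"
  shows "\<exists>B. ap3_free B \<and> B \<subseteq> {..<(2 * h) ^ m * (m * h\<^sup>2)} \<and> card B = h ^ m"
proof -
  let ?X = "{..<m} \<rightarrow>\<^sub>E {..<h}"
  define Q where "Q x = (\<Sum>i<m. (x i)\<^sup>2)" for x :: "nat \<Rightarrow> nat"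
  define \<phi> where "\<phi> x = (\<Sum>i<m. x i * (2 * h) ^ i) + (2 * h) ^ m * Q x" for x
  have bd: "x i < h" if "x \<in> ?X" "i < m" for x i
    using PiE_mem[OF that(1), of i] that(2) by auto
  have "inj_on \<phi> ?X"
  proof (rule inj_onI)
    fix x y assume xy: "x \<in> ?X" "y \<in> ?X" "\<phi> x = \<phi> y"
    have "\<forall>i<m. x i < 2 * h \<and> y i < 2 * h"
      using bd[OF xy(1)] bd[OF xy(2)] by fastforce
    then have "\<forall>i<m. x i = y i"
      using digits_unique[OF _ xy(3)[unfolded \<phi>_def]] assms(1) by simp
    then show "x = y"
      using xy by (intro PiE_ext[OF xy(1,2)]) auto
  qed
  then have "card (\<phi> ` ?X) = h ^ m"
    by (simp add: card_image card_PiE)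
  moreover have "ap3_free (\<phi> ` ?X)"
    unfolding ap3_free_def
  proof (clarify)
    fix x y z assume xyz: "x \<in> ?X" "y \<in> ?X" "z \<in> ?X" and eq: "\<phi> x + \<phi> z = 2 * \<phi> y"
    have "\<forall>i<m. x i + z i < 2 * h \<and> 2 * y i < 2 * h"
      using bd[OF xyz(1)] bd[OF xyz(2)] bd[OF xyz(3)] by (fastforce intro: add_less_mono)
    moreover have "(\<Sum>i<m. (x i + z i) * (2 * h) ^ i) + (2 * h) ^ m * (Q x + Q z) =
        (\<Sum>i<m. (2 * y i) * (2 * h) ^ i) + (2 * h) ^ m * (2 * Q y)"
      using eq by (simp add: \<phi>_def algebra_simps sum.distrib sum_distrib_left)
    ultimately have "(\<forall>i<m. x i + z i = 2 * y i) \<and> Q x + Q z = 2 * Q y"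
      using assms(1) by (intro digits_unique[of m _ "2 * h"]) simp_all
    then have dig: "\<forall>i<m. x i + z i = 2 * y i" and "Q x + Q z = 2 * Q y"
      by blast+
    \<comment> \<open>Doubling \<open>Q x + Q z = 2 * Q y\<close> turns the right side into the
      squared norm of \<open>2 * y\<close>, that is of \<open>x + z\<close>. Integers allow the
      differences \<open>x i - z i\<close> below.\<close>
    then have "2 * (\<Sum>i<m. (int (x i))\<^sup>2) + 2 * (\<Sum>i<m. (int (z i))\<^sup>2) = (\<Sum>i<m. (2 * int (y i))\<^sup>2)"
      by (simp add: Q_def power_mult_distrib flip: of_nat_power of_nat_sum sum_distrib_left)
    also have "\<dots> = (\<Sum>i<m. (int (x i) + int (z i))\<^sup>2)"
      using dig by (intro sum.cong) (auto simp flip: of_nat_add)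
    finally have *: "2 * (\<Sum>i<m. (int (x i))\<^sup>2) + 2 * (\<Sum>i<m. (int (z i))\<^sup>2) =
        (\<Sum>i<m. (int (x i) + int (z i))\<^sup>2)" .
    \<comment> \<open>Parallelogram law: compared with the previous identity, it leaves no room for
      \<open>x - z\<close>.\<close>
    have "(\<Sum>i<m. (int (x i) + int (z i))\<^sup>2) + (\<Sum>i<m. (int (x i) - int (z i))\<^sup>2) =
        2 * (\<Sum>i<m. (int (x i))\<^sup>2) + 2 * (\<Sum>i<m. (int (z i))\<^sup>2)"
      by (simp add: power2_sum power2_diff sum_distrib_left flip: sum.distrib)
    with * have "(\<Sum>i<m. (int (x i) - int (z i))\<^sup>2) = 0"
      by linarith
    then have "\<forall>i<m. x i = z i"
      by (subst (asm) sum_nonneg_eq_0_iff) auto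
    then have "\<forall>i<m. x i = y i"
      using dig by auto
    then have "x = y"
      by (intro PiE_ext[OF xyz(1,2)]) auto
    then show "\<phi> x = \<phi> y"
      by simp
  qed
  moreover have "\<phi> x < (2 * h) ^ m * (m * h\<^sup>2)" if x: "x \<in> ?X" for x
  proof -
    have "(x i)\<^sup>2 < h\<^sup>2" if "i < m" for i
      using bd[OF x that] by (intro power_strict_mono) auto
    then have "Q x < (\<Sum>i<m. h\<^sup>2)"
      unfolding Q_def using assms by (intro sum_strict_mono) auto
    \<comment> \<open>The strict bound on \<open>Q x\<close> leaves one spare unit of the leading
      place, which covers the lower digits.\<close>
    then have "(2 * h) ^ m * Suc (Q x) \<le> (2 * h) ^ m * (m * h\<^sup>2)"
      by (intro mult_left_mono) auto
    moreover have "(\<Sum>i<m. x i * (2 * h) ^ i) < (2 * h) ^ m"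
      using bd[OF x] by (intro digit_sum_less) fastforce
    ultimately show ?thesis
      by (simp add: \<phi>_def)
  qed
  ultimately show ?thesis
    by (intro exI[of _ "\<phi> ` ?X"]) auto
qed

section \<open>Density of corner-free sets and choice of parameters\<close>

lemma corner_max_density:
  fixes k m h :: nat
  assumes "k \<ge> 2" "h > 0" "m > 0" and n: "n = (2 * h) ^ m * (m * h\<^sup>2)"
  shows "n ^ k \<le> corner_max k n * (2 ^ Suc m * m * h\<^sup>2)"
proof -
  obtain B where B: "ap3_free B" "B \<subseteq> {..<n}" "card B = h ^ m"
    using exists_large_ap3_free[of h m] assms by auto
  have "even n"
    using assms by simp
  then obtain l where l: "n = 2 * l" ..
  have "n ^ k = n ^ (k - 2 + 2)"
    using \<open>k \<ge> 2\<close> by (simp only: le_add_diff_inverse2)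
  also have "\<dots> = n ^ (k - 2) * n * n"
    by (simp only: power_add power2_eq_square mult.assoc)
  also have "\<dots> = n ^ (k - 2) * (2 * l) * ((2 * h) ^ m * (m * h\<^sup>2))"
    using l n by simp
  \<comment> \<open>\<open>B\<close> has density \<open>1 / (2 ^ m * m * h\<^sup>2)\<close> in the
    interval of length \<open>n\<close>; the extra factor 2 comes from
    \<open>l = n / 2\<close>.\<close>
  also have "\<dots> = (card B * l * (2 * l) ^ (k - 2)) * (2 ^ Suc m * m * h\<^sup>2)"
    by (simp add: B(3) l power_mult_distrib)
  also have "\<dots> \<le> corner_max k n * (2 ^ Suc m * m * h\<^sup>2)"
    using corner_max_ge_ap3_free[of k B l] B \<open>k \<ge> 2\<close> l by (intro mult_right_mono) auto
  finally show ?thesis .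
qed

text \<open>Factoring \<open>ln h\<close> out of the logarithm leaves a convergent factor times
  \<open>ln h ^ e / h\<close>, which tends to 0.\<close>

lemma eventually_log_power_le_linear:
  fixes K K' :: real and p e :: nat
  assumes "K' > 0" "c > 0"
  shows "\<forall>\<^sub>F h in sequentially. log 2 (K' * real h ^ p) ^ e * K \<le> c * real h"
proof -
  have "((\<lambda>h. 1 / ln (real h)) \<longlongrightarrow> 0) sequentially"
    "((\<lambda>h. ln (real h) ^ e / real h) \<longlongrightarrow> 0) sequentially"
    by real_asymp+
  then have "((\<lambda>h. (ln K' / ln 2 * (1 / ln (real h)) + real p / ln 2) ^ e * K *
      (ln (real h) ^ e / real h)) \<longlongrightarrow> (ln K' / ln 2 * 0 + real p / ln 2) ^ e * K * 0) sequentially"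
    by (intro tendsto_intros)
  moreover have "\<forall>\<^sub>F h in sequentially. (ln K' / ln 2 * (1 / ln (real h)) + real p / ln 2) ^ e * K *
      (ln (real h) ^ e / real h) = (ln K' / ln 2 + real p / ln 2 * ln (real h)) ^ e * K / real h"
    using eventually_gt_at_top[of 1]
  proof eventually_elim
    case (elim h)
    then have "ln K' / ln 2 + real p / ln 2 * ln (real h) =
        (ln K' / ln 2 * (1 / ln (real h)) + real p / ln 2) * ln (real h)"
      by (simp add: distrib_right)
    then show ?case
      by (simp add: power_mult_distrib)
  qed
  ultimately have "((\<lambda>h. (ln K' / ln 2 + real p / ln 2 * ln (real h)) ^ e * K / real h) \<longlongrightarrow> 0) sequentially"
    by (simp only: tendsto_cong mult_zero_right)
  then have "\<forall>\<^sub>F h in sequentially.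
      (ln K' / ln 2 + real p / ln 2 * ln (real h)) ^ e * K / real h < c"
    using assms by (intro order_tendstoD)
  then show ?thesis
    using eventually_gt_at_top[of 0]
  proof eventually_elim
    case (elim h)
    have "log 2 (K' * real h ^ p) = ln K' / ln 2 + real p / ln 2 * ln (real h)"
      using elim assms by (simp add: log_def ln_mult ln_realpow add_divide_distrib)
    then have "log 2 (K' * real h ^ p) ^ e * K / real h < c"
      using elim(1) by (simp only:)
    then show ?case
      using elim(2) by (simp add: pos_divide_less_eq)
  qed
qed

theorem theorem6:
  fixes k :: nat
  assumes "k \<ge> 3"
  shows "\<exists>(C'::nat) (N :: nat \<Rightarrow> nat). C' > 0 \<and> strict_mono N \<and> (\<forall>i. N i > 0) \<and>
    (\<forall>n\<in>range N. \<forall>A. A \<subseteq> grid k n \<and> card A = C' * corner_max k n \<longrightarrow>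
      real (Gamma k n A) \<ge>
        log 2 (real n) ^ (3 * k + 1) * (real n ^ k / real (corner_max k n)) ^ k * real n ^ (k - 1) \<and>
      log 2 (real n) ^ (3 * k + 1) * (real n ^ k / real (corner_max k n)) ^ k * real n ^ (k - 1)
        = Upsilon k n * real n ^ k)"
proof -
  \<comment> \<open>The smallest \<open>m\<close> for which \<open>n\<close>, of order
    \<open>h ^ (m + 2)\<close>, beats \<open>k + 1\<close> density factors of order
    \<open>h\<^sup>2\<close>; one power of \<open>h\<close> is left to absorb logarithms and
    constants.\<close>
  define m where "m = 2 * k + 1"
  define c where "c = (2 ^ m * m :: nat)"
  define n where "n h = (2 * h) ^ m * (m * h\<^sup>2)" for h :: nat
  have "m > 0" "c > 0"
    by (simp_all add: m_def c_def)
  have n_eq: "n h = c * h ^ (2 * k + 3)" for h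
  proof -
    have "n h = c * (h ^ m * h ^ 2)"
      by (simp add: n_def c_def power_mult_distrib)
    also have "h ^ m * h ^ 2 = h ^ (2 * k + 3)"
      by (simp add: m_def eval_nat_numeral flip: power_add)
    finally show ?thesis .
  qed
  have "\<forall>\<^sub>F h in sequentially. log 2 (real c * real h ^ (2 * k + 3)) ^ (3 * k + 1) *
      real (2 * c) ^ Suc k \<le> real c * real h"
    using \<open>c > 0\<close> by (intro eventually_log_power_le_linear) auto
  then obtain h0 where h0: "log 2 (real c * real h ^ (2 * k + 3)) ^ (3 * k + 1) *
      real (2 * c) ^ Suc k \<le> real c * real h" if "h \<ge> h0" for h
    by (auto simp: eventually_sequentially)
  \<comment> \<open>\<open>Suc\<close> keeps \<open>h\<close> positive even if
    \<open>h0 = 0\<close>.\<close>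
  define N where "N i = n (Suc (h0 + i))" for i
  have N_pos: "N i > 0" for i
    using \<open>c > 0\<close> by (simp add: N_def n_eq)
  have "strict_mono N"
    unfolding strict_mono_Suc_iff N_def n_eq using \<open>c > 0\<close>
    by (auto intro!: mult_strict_left_mono power_strict_mono)
  moreover have "log 2 (real (N i)) ^ (3 * k + 1) * (real (N i) ^ k / real (corner_max k (N i))) ^ k *
      real (N i) ^ (k - 1) \<le> real (Gamma k (N i) A)"
    if A: "A \<subseteq> grid k (N i)" "card A = 2 * corner_max k (N i)" for i A
  proof -
    define h where "h = Suc (h0 + i)"
    let ?n = "N i" and ?M = "corner_max k (N i)"
    define L where "L = log 2 (real ?n) ^ (3 * k + 1)"
    define P where "P = real ?n ^ k / real ?M"
    have n: "?n = c * h ^ (2 * k + 3)"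
      by (simp add: N_def n_eq h_def)
    have "h > 0"
      by (simp add: h_def)
    have dens: "?n ^ k \<le> ?M * (2 * c * h\<^sup>2)"
      using corner_max_density[of k h m ?n] assms \<open>m > 0\<close>
      by (simp add: N_def n_def h_def c_def mult.assoc)
    then have M: "?M > 0"
      using N_pos[of i] by (cases "?M = 0") auto
    have "P > 0"
      using M N_pos[of i] by (simp add: P_def)
    have "real (?n ^ k) \<le> real (?M * (2 * c * h\<^sup>2))"
      using dens by (rule of_nat_mono)
    then have P_le: "P \<le> real (2 * c) * real h ^ 2"
      using M by (simp add: P_def divide_simps mult_ac)
    have "?n \<ge> 1"
      using N_pos[of i] by simp
    then have "L \<ge> 0"
      by (simp add: L_def)
    have "L * P ^ Suc k \<le> L * (real (2 * c) * real h ^ 2) ^ Suc k"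
      using P_le \<open>P > 0\<close> \<open>L \<ge> 0\<close> by (intro mult_left_mono power_mono) auto
    also have "\<dots> = (L * real (2 * c) ^ Suc k) * real h ^ (2 * k + 2)"
      by (simp only: power_mult_distrib power_mult[symmetric]) simp
    also have "\<dots> \<le> real c * real h * real h ^ (2 * k + 2)"
      using h0[of h] by (intro mult_right_mono) (auto simp: L_def n h_def)
    also have "\<dots> = real ?n"
      by (simp add: n eval_nat_numeral)
    finally have key: "L * P ^ Suc k \<le> real ?n" .
    \<comment> \<open>One more factor \<open>P\<close> is inserted to apply \<open>key\<close>;
      dividing it out turns \<open>?n ^ k\<close> into \<open>?M\<close>.\<close>
    have "L * P ^ k * real ?n ^ (k - 1) = L * P ^ Suc k * real ?n ^ (k - 1) / P"
      using \<open>P > 0\<close> by simp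
    also have "\<dots> \<le> real ?n * real ?n ^ (k - 1) / P"
      using key \<open>P > 0\<close> by (intro divide_right_mono mult_right_mono) auto
    also have "\<dots> = real ?n ^ k / P"
      using assms by (simp flip: power_Suc)
    also have "\<dots> = real ?M"
      using N_pos[of i] by (simp add: P_def)
    also have "\<dots> \<le> real (Gamma k ?n A)"
      using card_le_Gamma_plus_corner_max[OF A(1)] A(2) by simp
    finally show ?thesis
      by (simp add: L_def P_def)
  qed
  moreover have "log 2 (real (N i)) ^ (3 * k + 1) * (real (N i) ^ k / real (corner_max k (N i))) ^ k *
      real (N i) ^ (k - 1) = Upsilon k (N i) * real (N i) ^ k" for i
  proof -
    have "real (N i) ^ (k - 1) = real (N i) ^ k / real (N i)"
      using assms N_pos[of i] by (simp add: power_diff)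
    then show ?thesis
      by (simp add: Upsilon_def)
  qed
  ultimately show ?thesis
    using N_pos by (intro exI[of _ "2::nat"] exI[of _ N]) auto
qed

end
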